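(* Let $A\in\mathbb{R}^{d\times n}$ and suppose $\rho_A\le 0$. Then $|\rho_A^-|$ is the radius of the largest Euclidean ball of $\mathrm{lin}(A)$ centered at the origin that fits inside $\mathrm{conv}(A)$; precisely, $$|\rho_A^-|=\sup\Big\{R\in\mathbb{R}\ :\ \text{for all }\alpha\in\mathbb{R}^n,\ \|\alpha\|_G\le R\ \Rightarrow\ A\alpha\in\mathrm{conv}(A)\Big\}.$$
   Context: $\mathrm{conv}(A)$ is the convex hull of the columns of $A$, and $\mathrm{lin}(A)=\{A\alpha:\alpha\in\mathbb{R}^n\}$ is their linear span. $\triangle=\{p\in\mathbb{R}^n: p\ge\mathbf{0},\ \|p\|_1=1\}$ is the probability simplex; $\|\cdot\|$ is the Euclidean norm; $G=A^TA$ and $\|\alpha\|_G=\sqrt{\alpha^TG\alpha}=\|A\alpha\|$. The affine-margin of $A$ is $\rho_A:=\sup\{\inf_{p\in\triangle}w^TAp : w\in\mathrm{lin}(A),\ \|w\|=1\}$ (with $\sup\emptyset=-\infty$, relevant only if $A=0$, in which case both sides of the identity are $+\infty$), and $\rho_A^-:=\min\{0,\rho_A\}$. *)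

theory Defs
  imports "HOL-Analysis.Analysis"
begin

definition conv_cols :: "real^'n^'d \<Rightarrow> (real^'d) set" where
  "conv_cols A = convex hull (columns A)"

definition lin_cols :: "real^'n^'d \<Rightarrow> (real^'d) set" where
  "lin_cols A = {A *v \<alpha> | \<alpha>. True}"

definition prob_simplex :: "(real^'n) set" where
  "prob_simplex = {p. (\<forall>i. 0 \<le> p $ i) \<and> (\<Sum>i\<in>UNIV. \<bar>p $ i\<bar>) = 1}"

definition gram :: "real^'n^'d \<Rightarrow> real^'n^'n" where
  "gram A = transpose A ** A"

definition norm_gram :: "real^'n^'d \<Rightarrow> real^'n \<Rightarrow> real" where
  "norm_gram A \<alpha> = sqrt (\<alpha> \<bullet> (gram A *v \<alpha>))"

text \<open>The margin is an extended real because the supremum ranges over the empty set when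
  \<open>A = 0\<close>; in \<^typ>\<open>ereal\<close> it is then \<open>-\<infinity>\<close>.\<close>

definition affine_margin :: "real^'n^'d \<Rightarrow> ereal" where
  "affine_margin A =
     (SUP w\<in>{w. w \<in> lin_cols A \<and> norm w = 1}. INF p\<in>prob_simplex. ereal (w \<bullet> (A *v p)))"

definition affine_margin_neg :: "real^'n^'d \<Rightarrow> ereal" where
  "affine_margin_neg A = min 0 (affine_margin A)"

end

theory Submission
  imports Defs
begin

text \<open>If the ball of radius \<open>R\<close> in \<open>lin(A)\<close> lies in \<open>conv(A)\<close>, testing a unit vector \<open>w\<close> against the
  point \<open>- R w\<close> shows that its margin is at most \<open>- R\<close>. Conversely, a point of \<open>lin(A)\<close> outside
  \<open>conv(A)\<close> is strictly separated from it; projecting the normal of the separating hyperplane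
  onto \<open>lin(A)\<close> and normalising gives a \<open>w\<close> whose margin bounds the norm of the point from below.\<close>

text \<open>The transpose moves across the inner product. This turns a condition on coefficient
  vectors into one on points of \<open>lin_cols A\<close>.\<close>

lemma norm_gram_eq_norm: "norm_gram A \<alpha> = norm (A *v \<alpha>)"
proof -
  have "\<alpha> \<bullet> (gram A *v \<alpha>) = \<alpha> \<bullet> (transpose A *v (A *v \<alpha>))"
    by (simp only: gram_def matrix_vector_mul_assoc)
  also have "\<dots> = (A *v \<alpha>) \<bullet> (A *v \<alpha>)"
    by (simp only: vector_transpose_matrix flip: dot_lmul_matrix)
  finally show ?thesis
    by (simp add: norm_gram_def norm_eq_sqrt_inner)
qed

lemma prob_simplex_iff: "p \<in> prob_simplex \<longleftrightarrow> (\<forall>i. 0 \<le> p $ i) \<and> (\<Sum>i\<in>UNIV. p $ i) = 1"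
  by (auto simp: prob_simplex_def)

lemma convex_prob_simplex: "convex prob_simplex"
  by (auto simp: convex_def prob_simplex_iff sum.distrib simp flip: sum_distrib_left)

lemma axis_in_prob_simplex: "axis i 1 \<in> prob_simplex"
  by (auto simp: prob_simplex_iff axis_def)

text \<open>The image of the simplex is convex and contains each column as the image of an axis
  vector; conversely, \<open>A *v p\<close> is the combination of the columns with weights
  \<open>p $ i\<close>.\<close>

lemma conv_cols_eq_image:
  fixes A :: "real^'n^'d"
  shows "conv_cols A = (*v) A ` prob_simplex"
proof (rule subset_antisym)
  have "columns A \<subseteq> (*v) A ` prob_simplex"
    using axis_in_prob_simplex by (force simp: columns_def simp flip: matrix_vector_mult_basis)
  then show "conv_cols A \<subseteq> (*v) A ` prob_simplex"
    unfolding conv_cols_def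
    by (intro hull_minimal convex_linear_image convex_prob_simplex) auto
  show "(*v) A ` prob_simplex \<subseteq> conv_cols A"
  proof clarify
    fix p :: "real^'n" assume p: "p \<in> prob_simplex"
    have "(\<Sum>i\<in>UNIV. p $ i *\<^sub>R column i A) \<in> convex hull (columns A)"
      using p by (intro convex_sum) (auto simp: prob_simplex_iff columns_def intro!: hull_inc)
    then show "A *v p \<in> conv_cols A"
      by (simp add: conv_cols_def matrix_mult_sum scalar_mult_eq_scaleR)
  qed
qed

lemma conv_cols_nonempty: "conv_cols A \<noteq> {}"
  using axis_in_prob_simplex by (auto simp: conv_cols_eq_image)

lemma closed_conv_cols: "closed (conv_cols A)"
proof -
  have "columns A = range (\<lambda>i. column i A)"
    by (auto simp: columns_def)
  then show ?thesis
    by (simp add: conv_cols_def compact_imp_closed finite_imp_compact_convex_hull)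
qed

lemma subspace_lin_cols: "subspace (lin_cols A)"
  using linear_subspace_image[OF matrix_vector_mul_linear subspace_UNIV, of A]
  by (simp add: lin_cols_def full_SetCompr_eq)

lemma conv_cols_subset_lin_cols: "conv_cols A \<subseteq> lin_cols A"
  by (auto simp: conv_cols_eq_image lin_cols_def)

lemma affine_margin_eq:
  "affine_margin A =
    (SUP w\<in>{w. w \<in> lin_cols A \<and> norm w = 1}. INF x\<in>conv_cols A. ereal (w \<bullet> x))"
  by (simp add: affine_margin_def conv_cols_eq_image image_image)

lemma affine_margin_le_uminus:
  assumes "0 \<le> R" and ball: "\<And>x. x \<in> lin_cols A \<Longrightarrow> norm x \<le> R \<Longrightarrow> x \<in> conv_cols A"
  shows "affine_margin A \<le> ereal (- R)"
  unfolding affine_margin_eq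
proof (rule SUP_least)
  fix w assume "w \<in> {w. w \<in> lin_cols A \<and> norm w = 1}"
  then have w: "w \<in> lin_cols A" "norm w = 1" by auto
  \<comment> \<open>Since \<open>0 \<le> R\<close> and \<open>w\<close> is a unit vector, this point
    has norm exactly \<open>R\<close>; its inner product with \<open>w\<close> is
    \<open>- R\<close>.\<close>
  have "(- R) *\<^sub>R w \<in> conv_cols A"
    using w \<open>0 \<le> R\<close> by (intro ball subspace_scale subspace_lin_cols) auto
  then show "(INF x\<in>conv_cols A. ereal (w \<bullet> x)) \<le> ereal (- R)"
    using w by (intro INF_lower2) (auto simp: dot_square_norm)
qed

lemma uminus_norm_le_affine_margin:
  assumes z: "z \<in> lin_cols A" "z \<notin> conv_cols A"
  shows "ereal (- norm z) \<le> affine_margin A"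
proof -
  obtain a b where ab: "a \<bullet> z < b" "\<And>x. x \<in> conv_cols A \<Longrightarrow> b < a \<bullet> x"
    using separating_hyperplane_closed_point[OF _ closed_conv_cols z(2)]
    by (auto simp: conv_cols_def)
  \<comment> \<open>The margin only admits directions in \<open>lin_cols A\<close>, while
    \<open>a\<close> is arbitrary. Dropping the orthogonal part \<open>v\<close> keeps the
    separation, because \<open>z\<close> and the hull both lie in \<open>lin_cols A\<close>.\<close>
  obtain w v where w: "w \<in> span (lin_cols A)" and v: "\<And>x. x \<in> span (lin_cols A) \<Longrightarrow> orthogonal v x"
    and a: "a = w + v"
    using orthogonal_subspace_decomp_exists[of "lin_cols A" a] by metis
  have w_lin: "w \<in> lin_cols A"
    using w subspace_lin_cols by (metis span_eq_iff)
  have dot: "a \<bullet> x = w \<bullet> x" if "x \<in> lin_cols A" for x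
    using v[OF span_base[OF that]] by (simp add: a inner_left_distrib orthogonal_def)
  have sep: "w \<bullet> z < w \<bullet> x" if "x \<in> conv_cols A" for x
    using ab that dot z(1) conv_cols_subset_lin_cols by fastforce
  \<comment> \<open>For \<open>w = 0\<close>, any point of the nonempty hull would give
    \<open>0 < 0\<close> in \<open>sep\<close>.\<close>
  have "w \<noteq> 0"
    using sep conv_cols_nonempty by fastforce
  have unit_in: "w /\<^sub>R norm w \<in> {w. w \<in> lin_cols A \<and> norm w = 1}"
    using subspace_scale[OF subspace_lin_cols w_lin, of "inverse (norm w)"] \<open>w \<noteq> 0\<close> by simp
  \<comment> \<open>Cauchy-Schwarz bounds the value at \<open>z\<close> from below, and separation
    passes the bound on to the whole hull.\<close>
  have "ereal (- norm z) \<le> ereal ((w /\<^sub>R norm w) \<bullet> x)" if "x \<in> conv_cols A" for x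
  proof -
    have "- norm z \<le> (w /\<^sub>R norm w) \<bullet> z"
      using Cauchy_Schwarz_ineq2[of "w /\<^sub>R norm w" z] \<open>w \<noteq> 0\<close> by auto
    also have "\<dots> \<le> (w /\<^sub>R norm w) \<bullet> x"
      using sep[OF that] by (simp add: divide_right_mono less_imp_le field_simps)
    finally show ?thesis by simp
  qed
  then show ?thesis
    unfolding affine_margin_eq by (intro SUP_upper2[OF unit_in] INF_greatest)
qed

theorem proposition3:
  fixes A :: "real^'n^'d"
  assumes "affine_margin A \<le> 0"
  shows "\<bar>affine_margin_neg A\<bar> =
    Sup {ereal R | R :: real. \<forall>\<alpha>. norm_gram A \<alpha> \<le> R \<longrightarrow> A *v \<alpha> \<in> conv_cols A}"
    (is "_ = Sup ?S")
proof -
  \<comment> \<open>The case \<open>affine_margin A = -\<infinity>\<close> is included: both sides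
    are then \<open>\<infinity>\<close>.\<close>
  have "\<bar>affine_margin_neg A\<bar> = - affine_margin A"
    using assms by (cases "affine_margin A") (auto simp: affine_margin_neg_def min_def)
  also have "\<dots> = Sup ?S"
  proof (rule antisym)
    show "- affine_margin A \<le> Sup ?S"
    \<comment> \<open>Approaching from strictly below supplies a real radius even if the margin is
      infinite. Strictness gives the contradiction: a point outside the hull with norm at most
      \<open>r\<close> would force the margin to be at least \<open>- r\<close>.\<close>
    proof (rule dense_le)
      fix y assume y: "y < - affine_margin A"
      show "y \<le> Sup ?S"
      proof (cases y)
        case (real r)
        have "A *v \<alpha> \<in> conv_cols A" if "norm (A *v \<alpha>) \<le> r" for \<alpha>
        proof (rule ccontr)
          assume "A *v \<alpha> \<notin> conv_cols A"
          then have "ereal (- norm (A *v \<alpha>)) \<le> affine_margin A"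
            by (intro uminus_norm_le_affine_margin) (auto simp: lin_cols_def)
          then show False
            using y that real by (cases "affine_margin A") auto
        qed
        then show ?thesis
          unfolding real by (intro Sup_upper) (auto simp: norm_gram_eq_norm)
      qed (use y in auto)
    qed
    show "Sup ?S \<le> - affine_margin A"
    proof (rule Sup_least, clarify)
      fix R :: real
      assume R: "\<forall>\<alpha>. norm_gram A \<alpha> \<le> R \<longrightarrow> A *v \<alpha> \<in> conv_cols A"
      show "ereal R \<le> - affine_margin A"
      proof (cases "0 \<le> R")
        case True
        then have "affine_margin A \<le> ereal (- R)"
          using R by (intro affine_margin_le_uminus) (auto simp: lin_cols_def norm_gram_eq_norm)
        then show ?thesis
          by (cases "affine_margin A") auto
      next
        \<comment> \<open>Negative \<open>R\<close> satisfy the ball condition vacuously; they stay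
          below \<open>- affine_margin A\<close> because the margin is at most 0.\<close>
        case False
        then show ?thesis
          using assms by (cases "affine_margin A") auto
      qed
    qed
  qed
  finally show ?thesis .
qed

end
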